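(* Let $K\ge 1$ be an integer, $N_0>0$, $P>0$, $r^*\ge 0$, and let $h_1,\dots,h_K$ be nonzero complex numbers with $|h_1|\ge |h_2|\ge\dots\ge|h_K|$. Define $$P_{O2}^* = \min_{\alpha_1,\dots,\alpha_K>0,\ \sum_{i=1}^K\alpha_i=1} N_0\sum_{i=1}^{K}\frac{(e^{r^*/\alpha_i}-1)\alpha_i}{|h_i|^2}.$$ If $P_{O2}^*\le P$, then the OMA-TYPE-II optimization problem is feasible. Moreover, any optimal solution of it (a feasible point attaining the maximum, with objective value $R_{O2}$) satisfies $$R_{O2}\le R_N,$$ where $R_N$ is the optimal value of the NOMA optimization problem with the same data, and equality $R_{O2}=R_N$ holds only when $|h_1|=|h_2|=\dots=|h_K|$.
   Context: Data: $K$ users, channel coefficients $h_i$, noise power $N_0$, total power $P$, minimum rate $r^*$. NOMA optimization problem: $R_N$ is the maximum of $\sum_{i=1}^K r_i$ over $P_1,\dots,P_K\ge0$ subject to $r_i=\ln\Big(1+\frac{P_i|h_i|^2}{N_0+|h_i|^2\sum_{j=1}^{i-1}P_j}\Big)$ for $1\le i\le K$ (empty sum is $0$), $\sum_{i=1}^K P_i\le P$, and $\min_i r_i\ge r^*$. OMA-TYPE-II optimization problem: $R_{O2}$ is the maximum of $\sum_{i=1}^K r_i$ over powers $P_1,\dots,P_K\ge0$ and resource fractions $\alpha_1,\dots,\alpha_K>0$ subject to $r_i=\alpha_i\ln\Big(1+\frac{P_i|h_i|^2}{\alpha_iN_0}\Big)$ for $1\le i\le K$, $\sum_{i=1}^K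 P_i\le P$, $\min_i r_i\ge r^*$, and $\sum_{i=1}^K\alpha_i=1$. *)

theory Defs
  imports Complex_Main
begin

text \<open>
  Users are indexed by \<open>{1..K}\<close>; channel coefficients, powers and resource fractions are
  functions on \<open>nat\<close> of which only the values on \<open>{1..K}\<close> matter. Optimal values are rendered by
  \<open>LEAST\<close> and \<open>GREATEST\<close>, i.e. as genuine minima and maxima: nothing can be deduced about them
  unless the optimum is shown to be attained.
\<close>

definition noma_rate :: "(nat \<Rightarrow> complex) \<Rightarrow> real \<Rightarrow> (nat \<Rightarrow> real) \<Rightarrow> nat \<Rightarrow> real" where
  "noma_rate h N0 p i =
     ln (1 + p i * (cmod (h i))\<^sup>2 / (N0 + (cmod (h i))\<^sup>2 * (\<Sum>j\<in>{1..<i}. p j)))"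

definition noma_feasible ::
  "nat \<Rightarrow> (nat \<Rightarrow> complex) \<Rightarrow> real \<Rightarrow> real \<Rightarrow> real \<Rightarrow> (nat \<Rightarrow> real) \<Rightarrow> bool" where
  "noma_feasible K h N0 P rmin p \<longleftrightarrow>
     (\<forall>i\<in>{1..K}. 0 \<le> p i) \<and>
     (\<Sum>i\<in>{1..K}. p i) \<le> P \<and>
     Min (noma_rate h N0 p ` {1..K}) \<ge> rmin"

definition noma_sum_rate :: "nat \<Rightarrow> (nat \<Rightarrow> complex) \<Rightarrow> real \<Rightarrow> (nat \<Rightarrow> real) \<Rightarrow> real" where
  "noma_sum_rate K h N0 p = (\<Sum>i\<in>{1..K}. noma_rate h N0 p i)"

definition noma_opt_value :: "nat \<Rightarrow> (nat \<Rightarrow> complex) \<Rightarrow> real \<Rightarrow> real \<Rightarrow> real \<Rightarrow> real" where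
  "noma_opt_value K h N0 P rmin =
     (GREATEST R. \<exists>p. noma_feasible K h N0 P rmin p \<and> R = noma_sum_rate K h N0 p)"

definition resource_fractions :: "nat \<Rightarrow> (nat \<Rightarrow> real) \<Rightarrow> bool" where
  "resource_fractions K \<alpha> \<longleftrightarrow> (\<forall>i\<in>{1..K}. 0 < \<alpha> i) \<and> (\<Sum>i\<in>{1..K}. \<alpha> i) = 1"

definition oma2_rate ::
  "(nat \<Rightarrow> complex) \<Rightarrow> real \<Rightarrow> (nat \<Rightarrow> real) \<Rightarrow> (nat \<Rightarrow> real) \<Rightarrow> nat \<Rightarrow> real" where
  "oma2_rate h N0 p \<alpha> i = \<alpha> i * ln (1 + p i * (cmod (h i))\<^sup>2 / (\<alpha> i * N0))"

definition oma2_feasible ::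
  "nat \<Rightarrow> (nat \<Rightarrow> complex) \<Rightarrow> real \<Rightarrow> real \<Rightarrow> real \<Rightarrow> (nat \<Rightarrow> real) \<Rightarrow> (nat \<Rightarrow> real) \<Rightarrow> bool" where
  "oma2_feasible K h N0 P rmin p \<alpha> \<longleftrightarrow>
     (\<forall>i\<in>{1..K}. 0 \<le> p i) \<and>
     resource_fractions K \<alpha> \<and>
     (\<Sum>i\<in>{1..K}. p i) \<le> P \<and>
     Min (oma2_rate h N0 p \<alpha> ` {1..K}) \<ge> rmin"

definition oma2_sum_rate ::
  "nat \<Rightarrow> (nat \<Rightarrow> complex) \<Rightarrow> real \<Rightarrow> (nat \<Rightarrow> real) \<Rightarrow> (nat \<Rightarrow> real) \<Rightarrow> real" where
  "oma2_sum_rate K h N0 p \<alpha> = (\<Sum>i\<in>{1..K}. oma2_rate h N0 p \<alpha> i)"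

definition oma2_optimal ::
  "nat \<Rightarrow> (nat \<Rightarrow> complex) \<Rightarrow> real \<Rightarrow> real \<Rightarrow> real \<Rightarrow> (nat \<Rightarrow> real) \<Rightarrow> (nat \<Rightarrow> real) \<Rightarrow> bool" where
  "oma2_optimal K h N0 P rmin p \<alpha> \<longleftrightarrow>
     oma2_feasible K h N0 P rmin p \<alpha> \<and>
     (\<forall>q \<beta>. oma2_feasible K h N0 P rmin q \<beta> \<longrightarrow>
        oma2_sum_rate K h N0 q \<beta> \<le> oma2_sum_rate K h N0 p \<alpha>)"

definition oma2_min_power :: "nat \<Rightarrow> (nat \<Rightarrow> complex) \<Rightarrow> real \<Rightarrow> real \<Rightarrow> real" where
  "oma2_min_power K h N0 rmin =
     (LEAST Q. \<exists>\<alpha>. resource_fractions K \<alpha> \<and>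
        Q = N0 * (\<Sum>i\<in>{1..K}. (exp (rmin / \<alpha> i) - 1) * \<alpha> i / (cmod (h i))\<^sup>2))"

end

theory Submission
  imports Defs "HOL-Analysis.Function_Metric"
begin

text \<open>
  Given an OMA-TYPE-II point with rates \<open>R\<^sub>i\<close>, let NOMA realise exactly the same rates.  With
  \<open>n\<^sub>i = N\<^sub>0 / |h\<^sub>i|\<^sup>2\<close>, which increases with \<open>i\<close>, and \<open>d\<^sub>i = n\<^sub>i - n\<^sub>i\<^sub>-\<^sub>1\<close> (where \<open>n\<^sub>0 = 0\<close>), Abel summation
  turns the power used by NOMA into \<open>\<Sum>\<^sub>i d\<^sub>i (exp (\<Sum>\<^sub>j\<^sub>\<ge>\<^sub>i R\<^sub>j) - 1)\<close> and that used by OMA into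
  \<open>\<Sum>\<^sub>i d\<^sub>i \<Sum>\<^sub>j\<^sub>\<ge>\<^sub>i \<alpha>\<^sub>j (exp (R\<^sub>j / \<alpha>\<^sub>j) - 1)\<close>.  Jensen's inequality for \<open>exp\<close>, with the missing weight placed
  at \<open>0\<close>, compares the two sums term by term.  If the gains differ, some term is strict
  unless all rates vanish, in which case NOMA uses no power at all; either way the power
  left over raises the rate of user \<open>K\<close>, whose signal interferes with nobody.
\<close>

section \<open>Attainment of the optima\<close>

text \<open>Tychonoff's theorem: all but the coordinates in \<open>I\<close> are pinned to the
  single value 0, so every factor of the product is compact.\<close>

lemma compact_fun_box:
  fixes a b :: real
  shows "compact {x :: nat \<Rightarrow> real. (\<forall>i\<in>I. a \<le> x i \<and> x i \<le> b) \<and> (\<forall>i. i \<notin> I \<longrightarrow> x i = 0)}"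
proof -
  let ?B = "\<lambda>i. if i \<in> I then {a..b} else {0::real}"
  have "compactin (product_topology (\<lambda>_. euclidean) UNIV) (PiE UNIV ?B)"
    unfolding compactin_PiE by auto
  then have "compact (PiE UNIV ?B)"
    by (simp add: euclidean_product_topology)
  moreover have "PiE UNIV ?B =
      {x. (\<forall>i\<in>I. a \<le> x i \<and> x i \<le> b) \<and> (\<forall>i. i \<notin> I \<longrightarrow> x i = 0)}"
    by (fastforce simp: PiE_def Pi_def split: if_splits)
  ultimately show ?thesis by simp
qed

lemma continuous_on_coordinate: "continuous_on A (\<lambda>x :: nat \<Rightarrow> real. x i)"
  by (rule continuous_on_subset[OF continuous_on_product_coordinates]) simp

section \<open>The minimal power of OMA-TYPE-II\<close>

definition oma2_power :: "nat \<Rightarrow> (nat \<Rightarrow> complex) \<Rightarrow> real \<Rightarrow> real \<Rightarrow> (nat \<Rightarrow> real) \<Rightarrow> real" where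
  "oma2_power K h N0 r \<alpha> = N0 * (\<Sum>i\<in>{1..K}. (exp (r / \<alpha> i) - 1) * \<alpha> i / (cmod (h i))\<^sup>2)"

text \<open>Coercivity at the boundary of the simplex. All summands are nonnegative, and
  \<open>exp x - 1\<close> is at least half the square of \<open>x\<close> for nonnegative
  \<open>x\<close>, so for positive \<open>r\<close> the power blows up as a single fraction tends
  to 0.\<close>

lemma oma2_power_ge_inverse:
  fixes N0 r :: real
  assumes "0 < N0" "0 \<le> r" "\<forall>j\<in>{1..K}. 0 < \<alpha> j" "i \<in> {1..K}"
  shows "N0 * r\<^sup>2 / (2 * (cmod (h i))\<^sup>2 * \<alpha> i) \<le> oma2_power K h N0 r \<alpha>"
proof -
  have pos: "0 < \<alpha> i" using assms by blast
  have "(r / \<alpha> i)\<^sup>2 / 2 \<le> exp (r / \<alpha> i) - 1"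
    using exp_lower_Taylor_quadratic[of "r / \<alpha> i"] assms(2) pos
      divide_nonneg_pos[of r "\<alpha> i"] by linarith
  then have "(r / \<alpha> i)\<^sup>2 / 2 * \<alpha> i / (cmod (h i))\<^sup>2 \<le> (exp (r / \<alpha> i) - 1) * \<alpha> i / (cmod (h i))\<^sup>2"
    by (intro divide_right_mono mult_right_mono) (use pos in auto)
  also have "\<dots> \<le> (\<Sum>i\<in>{1..K}. (exp (r / \<alpha> i) - 1) * \<alpha> i / (cmod (h i))\<^sup>2)"
  proof (rule member_le_sum[OF assms(4)])
    fix j assume "j \<in> {1..K} - {i}"
    then have "0 < \<alpha> j" using assms by blast
    then show "0 \<le> (exp (r / \<alpha> j) - 1) * \<alpha> j / (cmod (h j))\<^sup>2"
      using assms(2) by (intro divide_nonneg_nonneg mult_nonneg_nonneg) auto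
  qed simp
  finally have "N0 * ((r / \<alpha> i)\<^sup>2 / 2 * \<alpha> i / (cmod (h i))\<^sup>2) \<le> oma2_power K h N0 r \<alpha>"
    unfolding oma2_power_def using assms(1) by (intro mult_left_mono) auto
  moreover have "(r / \<alpha> i)\<^sup>2 / 2 * \<alpha> i = r\<^sup>2 / (2 * \<alpha> i)"
    using pos by (simp add: field_simps power2_eq_square)
  ultimately show ?thesis by (simp add: mult.assoc mult.left_commute mult.commute)
qed

text \<open>The fractions range over an open simplex, which is not compact. By coercivity, though,
  every point that needs no more power than the uniform fractions \<open>u\<close> has all its
  fractions above some \<open>d > 0\<close>, so it suffices to minimise over the compact part
  \<open>C\<close> of the simplex.\<close>

lemma oma2_power_attains_min:
  fixes N0 r :: real
  assumes "1 \<le> K" "0 < N0" "0 < r" and h: "\<forall>i\<in>{1..K}. h i \<noteq> 0"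
  shows "\<exists>\<alpha>. resource_fractions K \<alpha> \<and>
    (\<forall>\<beta>. resource_fractions K \<beta> \<longrightarrow> oma2_power K h N0 r \<alpha> \<le> oma2_power K h N0 r \<beta>)"
proof -
  define u where "u = (\<lambda>i. if i \<in> {1..K} then 1 / real K else 0)"
  have u: "resource_fractions K u"
    using assms(1) by (simp add: resource_fractions_def u_def)
  define F where "F = oma2_power K h N0 r u"
  define G where "G = Max ((\<lambda>i. (cmod (h i))\<^sup>2) ` {1..K})"
  have G: "(cmod (h i))\<^sup>2 \<le> G" if "i \<in> {1..K}" for i
    unfolding G_def using that by (intro Max_ge) auto
  have Gpos: "0 < G"
    using G[of 1] h assms(1) by (smt (verit) atLeastAtMost_iff le_refl zero_less_norm_iff zero_less_power)
  have F: "0 < F"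
  proof -
    have "0 < N0 * r\<^sup>2 / (2 * (cmod (h 1))\<^sup>2 * u 1)"
      using assms by (auto simp: u_def)
    also have "\<dots> \<le> F"
      unfolding F_def using u assms
      by (intro oma2_power_ge_inverse) (auto simp: resource_fractions_def)
    finally show ?thesis .
  qed
  \<comment> \<open>The bound of \<open>oma2_power_ge_inverse\<close> with right-hand side
    \<open>F\<close>, solved for the fraction; the largest squared gain \<open>G\<close> makes it
    the same for all users.\<close>
  define d where "d = N0 * r\<^sup>2 / (2 * G * F)"
  have d: "0 < d" using assms F Gpos by (simp add: d_def)
  have low: "d \<le> \<beta> i" if "resource_fractions K \<beta>" "oma2_power K h N0 r \<beta> \<le> F" "i \<in> {1..K}" for \<beta> i
  proof -
    have b: "0 < \<beta> i" using that by (auto simp: resource_fractions_def)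
    have g: "0 < (cmod (h i))\<^sup>2" using h that by auto
    have "N0 * r\<^sup>2 / (2 * G * \<beta> i) \<le> N0 * r\<^sup>2 / (2 * (cmod (h i))\<^sup>2 * \<beta> i)"
      using G[OF that(3)] b g assms by (intro divide_left_mono mult_right_mono) (auto simp: Gpos)
    also have "\<dots> \<le> F"
      using oma2_power_ge_inverse[of N0 r K \<beta> i h] that assms by (auto simp: resource_fractions_def)
    finally show ?thesis
      using b Gpos F by (simp add: d_def field_simps)
  qed
  have le1: "\<beta> i \<le> 1" if "resource_fractions K \<beta>" "i \<in> {1..K}" for \<beta> i
    using that member_le_sum[of i "{1..K}" \<beta>] by (force simp: resource_fractions_def less_imp_le)
  define B where "B = {x :: nat \<Rightarrow> real. (\<forall>i\<in>{1..K}. d \<le> x i \<and> x i \<le> 1) \<and> (\<forall>i. i \<notin> {1..K} \<longrightarrow> x i = 0)}"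
  define C where "C = B \<inter> {x. (\<Sum>i\<in>{1..K}. x i) = 1}"
  have "closed {x :: nat \<Rightarrow> real. (\<Sum>i\<in>{1..K}. x i) = 1}"
    by (intro closed_Collect_eq continuous_on_sum continuous_on_coordinate continuous_on_const)
  then have "compact C"
    unfolding C_def B_def by (intro compact_Int_closed compact_fun_box)
  moreover have "u \<in> C"
    using low[OF u] le1[OF u] u by (auto simp: C_def B_def F_def resource_fractions_def) (auto simp: u_def)
  moreover have "continuous_on C (oma2_power K h N0 r)"
  proof -
    have "\<alpha> i \<noteq> 0" if "\<alpha> \<in> C" "i \<in> {1..K}" for \<alpha> i
      using that d less_le_trans[of 0 d "\<alpha> i"] by (simp add: C_def B_def less_imp_neq[symmetric])
    moreover have "(cmod (h i))\<^sup>2 \<noteq> 0" if "i \<in> {1..K}" for i using h that by simp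
    ultimately show ?thesis
      unfolding oma2_power_def
      by (intro continuous_on_mult continuous_on_const continuous_on_sum continuous_on_divide
          continuous_on_diff continuous_on_exp continuous_on_coordinate ballI) blast+
  qed
  ultimately obtain \<alpha> where \<alpha>: "\<alpha> \<in> C" "\<And>\<beta>. \<beta> \<in> C \<Longrightarrow> oma2_power K h N0 r \<alpha> \<le> oma2_power K h N0 r \<beta>"
    using continuous_attains_inf[of C "oma2_power K h N0 r"] by blast
  show ?thesis
  proof (intro exI[of _ \<alpha>] conjI allI impI)
    show "resource_fractions K \<alpha>"
      using \<alpha>(1) d by (force simp: C_def B_def resource_fractions_def)
    fix \<beta> assume b: "resource_fractions K \<beta>"
    show "oma2_power K h N0 r \<alpha> \<le> oma2_power K h N0 r \<beta>"
    proof (cases "oma2_power K h N0 r \<beta> \<le> F")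
      case True
      define \<gamma> where "\<gamma> = (\<lambda>i. if i \<in> {1..K} then \<beta> i else 0)"
      have "\<gamma> \<in> C"
        using low[OF b True] le1[OF b] b by (auto simp: \<gamma>_def C_def B_def resource_fractions_def)
      moreover have "oma2_power K h N0 r \<gamma> = oma2_power K h N0 r \<beta>"
        by (simp add: oma2_power_def \<gamma>_def)
      ultimately show ?thesis using \<alpha>(2) by metis
    next
      case False
      then show ?thesis using \<alpha>(2)[OF \<open>u \<in> C\<close>] by (simp add: F_def)
    qed
  qed
qed

text \<open>Gives the \<open>LEAST\<close> its meaning as a true minimum. For \<open>r = 0\<close>
  coercivity is lost, but then the power is 0 at all fractions.\<close>

lemma oma2_min_power_attained:
  fixes N0 r :: real
  assumes "1 \<le> K" "0 < N0" "0 \<le> r" and h: "\<forall>i\<in>{1..K}. h i \<noteq> 0"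
  shows "\<exists>\<alpha>. resource_fractions K \<alpha> \<and> oma2_min_power K h N0 r = oma2_power K h N0 r \<alpha>"
proof -
  have "\<exists>\<alpha>. resource_fractions K \<alpha> \<and>
    (\<forall>\<beta>. resource_fractions K \<beta> \<longrightarrow> oma2_power K h N0 r \<alpha> \<le> oma2_power K h N0 r \<beta>)"
  proof (cases "r = 0")
    case True
    have "resource_fractions K (\<lambda>i. 1 / real K)"
      using assms(1) by (simp add: resource_fractions_def)
    then show ?thesis using True by (auto simp: oma2_power_def)
  next
    case False
    then show ?thesis using oma2_power_attains_min assms by simp
  qed
  then obtain \<alpha> where \<alpha>: "resource_fractions K \<alpha>"
    "\<And>\<beta>. resource_fractions K \<beta> \<Longrightarrow> oma2_power K h N0 r \<alpha> \<le> oma2_power K h N0 r \<beta>" by blast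
  have "oma2_min_power K h N0 r = oma2_power K h N0 r \<alpha>"
    unfolding oma2_min_power_def oma2_power_def[symmetric]
    by (rule Least_equality) (use \<alpha> in auto)
  with \<alpha> show ?thesis by blast
qed

section \<open>The NOMA optimum\<close>

lemma noma_rate_cong:
  assumes "\<And>j. j \<in> {1..i} \<Longrightarrow> p j = q j" "1 \<le> i"
  shows "noma_rate h N0 p i = noma_rate h N0 q i"
proof -
  have "(\<Sum>j\<in>{1..<i}. p j) = (\<Sum>j\<in>{1..<i}. q j)"
    using assms by (intro sum.cong) auto
  then show ?thesis using assms by (simp add: noma_rate_def)
qed

lemma noma_feasible_iff:
  assumes "1 \<le> K"
  shows "noma_feasible K h N0 P r p \<longleftrightarrow>
    (\<forall>i\<in>{1..K}. 0 \<le> p i) \<and> (\<Sum>i\<in>{1..K}. p i) \<le> P \<and> (\<forall>i\<in>{1..K}. r \<le> noma_rate h N0 p i)"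
  using assms by (simp add: noma_feasible_def)

text \<open>The total power bounds each single power by \<open>P\<close>, so the feasible points
  that vanish outside the users form a closed subset of a compact box, on which the sum rate is
  continuous.\<close>

lemma noma_opt_value_attained:
  fixes N0 P r :: real
  assumes "1 \<le> K" "0 < N0" "noma_feasible K h N0 P r p0"
  shows "\<exists>p. noma_feasible K h N0 P r p \<and> noma_opt_value K h N0 P r = noma_sum_rate K h N0 p \<and>
    (\<forall>q. noma_feasible K h N0 P r q \<longrightarrow> noma_sum_rate K h N0 q \<le> noma_sum_rate K h N0 p)"
proof -
  define B where "B = {x :: nat \<Rightarrow> real. (\<forall>i\<in>{1..K}. 0 \<le> x i \<and> x i \<le> P) \<and> (\<forall>i. i \<notin> {1..K} \<longrightarrow> x i = 0)}"
  have compB: "compact B" unfolding B_def by (rule compact_fun_box)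
  then have closB: "closed B" by (rule compact_imp_closed)
  \<comment> \<open>Nonnegative powers keep the denominator positive and the argument of
    \<open>ln\<close> at least 1.\<close>
  have cont: "continuous_on B (\<lambda>p. noma_rate h N0 p i)" if i: "i \<in> {1..K}" for i
  proof -
    have den: "0 < N0 + (cmod (h i))\<^sup>2 * (\<Sum>j\<in>{1..<i}. p j)" if "p \<in> B" for p
      using that i assms(2) by (intro add_pos_nonneg mult_nonneg_nonneg sum_nonneg) (auto simp: B_def)
    have den': "N0 + (cmod (h i))\<^sup>2 * (\<Sum>j\<in>{1..<i}. p j) \<noteq> 0" if "p \<in> B" for p
      using den[OF that] by simp
    have arg: "1 + p i * (cmod (h i))\<^sup>2 / (N0 + (cmod (h i))\<^sup>2 * (\<Sum>j\<in>{1..<i}. p j)) \<noteq> 0"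
      if p: "p \<in> B" for p
    proof -
      have "0 \<le> p i * (cmod (h i))\<^sup>2 / (N0 + (cmod (h i))\<^sup>2 * (\<Sum>j\<in>{1..<i}. p j))"
        using p i den[OF p] by (intro divide_nonneg_pos mult_nonneg_nonneg) (simp_all add: B_def)
      then show ?thesis by linarith
    qed
    show ?thesis
      unfolding noma_rate_def
      by (intro continuous_on_ln continuous_on_add continuous_on_divide continuous_on_mult
          continuous_on_const continuous_on_sum continuous_on_coordinate ballI den' arg)
  qed
  define C where "C = {p \<in> B. (\<Sum>i\<in>{1..K}. p i) \<le> P} \<inter> (\<Inter>i\<in>{1..K}. {p \<in> B. r \<le> noma_rate h N0 p i})"
  have "closed {p \<in> B. (\<Sum>i\<in>{1..K}. p i) \<le> P}"
    by (intro continuous_on_closed_Collect_le closB continuous_on_sum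
        continuous_on_coordinate continuous_on_const)
  moreover have "closed (\<Inter>i\<in>{1..K}. {p \<in> B. r \<le> noma_rate h N0 p i})"
    by (intro closed_INT ballI continuous_on_closed_Collect_le closB continuous_on_const cont)
  ultimately have "closed C" unfolding C_def by (rule closed_Int)
  then have "compact (B \<inter> C)" using compB by (rule compact_Int_closed[rotated])
  moreover have "B \<inter> C = C" by (auto simp: C_def)
  ultimately have compC: "compact C" by simp
  have restr: "\<exists>p'\<in>C. noma_sum_rate K h N0 p' = noma_sum_rate K h N0 p" if f: "noma_feasible K h N0 P r p" for p
  proof
    let ?p = "\<lambda>i. if i \<in> {1..K} then p i else 0"
    have f': "\<And>i. i \<in> {1..K} \<Longrightarrow> 0 \<le> p i" "(\<Sum>i\<in>{1..K}. p i) \<le> P"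
      "\<And>i. i \<in> {1..K} \<Longrightarrow> r \<le> noma_rate h N0 p i"
      using f noma_feasible_iff[OF assms(1)] by blast+
    have rate: "noma_rate h N0 ?p i = noma_rate h N0 p i" if "i \<in> {1..K}" for i
      using that by (intro noma_rate_cong) auto
    show "noma_sum_rate K h N0 ?p = noma_sum_rate K h N0 p"
      unfolding noma_sum_rate_def by (intro sum.cong rate) auto
    have "p i \<le> P" if "i \<in> {1..K}" for i
      using member_le_sum[of i "{1..K}" p] that f'(1,2) by fastforce
    then have "?p \<in> B" using f' by (auto simp: B_def)
    then show "?p \<in> C" using f' rate by (simp add: C_def)
  qed
  obtain p0' where "p0' \<in> C" using restr[OF assms(3)] by blast
  moreover have "continuous_on C (noma_sum_rate K h N0)"
    unfolding noma_sum_rate_def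
    by (intro continuous_on_sum continuous_on_subset[OF cont]) (auto simp: C_def)
  ultimately obtain p where p: "p \<in> C"
    "\<And>q. q \<in> C \<Longrightarrow> noma_sum_rate K h N0 q \<le> noma_sum_rate K h N0 p"
    using continuous_attains_sup[OF compC, of "noma_sum_rate K h N0"] by blast
  have f: "noma_feasible K h N0 P r p"
    using p(1) unfolding noma_feasible_iff[OF assms(1)] by (auto simp: C_def B_def)
  have max: "noma_sum_rate K h N0 q \<le> noma_sum_rate K h N0 p" if "noma_feasible K h N0 P r q" for q
    using restr[OF that] p(2) by metis
  have "noma_opt_value K h N0 P r = noma_sum_rate K h N0 p"
    unfolding noma_opt_value_def by (rule Greatest_equality) (use f max in auto)
  with f max show ?thesis by blast
qed

section \<open>Comparison of the powers for prescribed rates\<close>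

text \<open>Replace \<open>exp\<close> by its tangent at the total \<open>m\<close>, which lies
  below it. Strictness has two sources when \<open>m\<close> is nonzero: a positive missing weight,
  whose point 0 differs from \<open>m\<close>, or a user whose point \<open>R j / \<alpha> j\<close>
  is 0.\<close>

lemma exp_sum_jensen:
  fixes R \<alpha> :: "nat \<Rightarrow> real"
  assumes "finite J" and pos: "\<forall>j\<in>J. 0 < \<alpha> j" and A: "(\<Sum>j\<in>J. \<alpha> j) \<le> 1"
  shows "exp (\<Sum>j\<in>J. R j) - 1 \<le> (\<Sum>j\<in>J. \<alpha> j * (exp (R j / \<alpha> j) - 1))" (is ?le)
    and "(\<Sum>j\<in>J. R j) \<noteq> 0 \<Longrightarrow> (\<Sum>j\<in>J. \<alpha> j) < 1 \<or> (\<exists>j\<in>J. R j = 0) \<Longrightarrow>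
      exp (\<Sum>j\<in>J. R j) - 1 < (\<Sum>j\<in>J. \<alpha> j * (exp (R j / \<alpha> j) - 1))" (is "_ \<Longrightarrow> _ \<Longrightarrow> ?less")
proof -
  define m where "m = (\<Sum>j\<in>J. R j)"
  define A where "A = (\<Sum>j\<in>J. \<alpha> j)"
  \<comment> \<open>The \<open>j\<close>-th summand of the right-hand side with \<open>exp\<close>
    replaced by its tangent at \<open>m\<close>, multiplied out to avoid the division.\<close>
  define f where "f = (\<lambda>j. exp m * (\<alpha> j * (1 - m) + R j) - \<alpha> j)"
  have tangent: "exp m * (1 + x - m) \<le> exp x" "x \<noteq> m \<Longrightarrow> exp m * (1 + x - m) < exp x" for x
  proof -
    have e: "exp m * exp (x - m) = exp x" by (simp add: mult_exp_exp)
    have "exp m * (1 + (x - m)) \<le> exp m * exp (x - m)"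
      by (intro mult_left_mono exp_ge_add_one_self) simp_all
    then show "exp m * (1 + x - m) \<le> exp x" by (simp add: e add_diff_eq)
    assume "x \<noteq> m"
    then have "exp m * (1 + (x - m)) < exp m * exp (x - m)"
      using exp_minus_greater[of "m - x"] by (intro mult_strict_left_mono) auto
    then show "exp m * (1 + x - m) < exp x" by (simp add: e add_diff_eq)
  qed
  have f: "f j = \<alpha> j * (exp m * (1 + R j / \<alpha> j - m) - 1)" if "j \<in> J" for j
  proof -
    have "\<alpha> j \<noteq> 0" using pos that by force
    then show ?thesis by (simp add: f_def field_simps)
  qed
  have f_le: "f j \<le> \<alpha> j * (exp (R j / \<alpha> j) - 1)" if "j \<in> J" for j
    unfolding f[OF that] using pos that tangent(1)[of "R j / \<alpha> j"]
    by (intro mult_left_mono) (auto simp: less_imp_le)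
  have f_less: "f j < \<alpha> j * (exp (R j / \<alpha> j) - 1)" if "j \<in> J" "R j / \<alpha> j \<noteq> m" for j
    unfolding f[OF that(1)] using pos that tangent(2)[of "R j / \<alpha> j"]
    by (intro mult_strict_left_mono) auto
  have sum_f: "(\<Sum>j\<in>J. f j) = exp m * (A * (1 - m) + m) - A"
    by (simp add: f_def sum_subtractf sum_distrib_left[symmetric] sum.distrib
        sum_distrib_right[symmetric] A_def m_def)
  \<comment> \<open>The missing weight times the gap between \<open>exp\<close> and the tangent at
    0.\<close>
  have residual: "(\<Sum>j\<in>J. f j) - (exp m - 1) = (1 - A) * (1 - exp m * (1 - m))"
    unfolding sum_f by (simp add: algebra_simps)
  have at0: "exp m * (1 - m) \<le> 1" "m \<noteq> 0 \<Longrightarrow> exp m * (1 - m) < 1"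
    using tangent[of 0] by auto
  have A1: "A \<le> 1" using assms by (simp add: A_def)
  have le1: "exp m - 1 \<le> (\<Sum>j\<in>J. f j)"
  proof -
    have "0 \<le> (1 - A) * (1 - exp m * (1 - m))"
      using at0(1) A1 by (intro mult_nonneg_nonneg) auto
    then show ?thesis using residual by linarith
  qed
  have le2: "(\<Sum>j\<in>J. f j) \<le> (\<Sum>j\<in>J. \<alpha> j * (exp (R j / \<alpha> j) - 1))"
    by (intro sum_mono f_le)
  show ?le using le1 le2 by (simp add: m_def)
  assume m: "(\<Sum>j\<in>J. R j) \<noteq> 0" and "(\<Sum>j\<in>J. \<alpha> j) < 1 \<or> (\<exists>j\<in>J. R j = 0)"
  then consider "A < 1" | j where "j \<in> J" "R j = 0" by (auto simp: A_def)
  then show ?less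
  proof cases
    case 1
    then have "0 < (1 - A) * (1 - exp m * (1 - m))"
      using at0(2) m by (intro mult_pos_pos) (auto simp: m_def)
    then show ?thesis using residual le2 by (simp add: m_def)
  next
    case 2
    then have "f j < \<alpha> j * (exp (R j / \<alpha> j) - 1)" using m by (intro f_less) (simp_all add: m_def)
    then have "(\<Sum>j\<in>J. f j) < (\<Sum>j\<in>J. \<alpha> j * (exp (R j / \<alpha> j) - 1))"
      using 2 f_le \<open>finite J\<close> by (intro sum_strict_mono_ex1 ballI bexI[of _ j])
    then show ?thesis using le1 by (simp add: m_def)
  qed
qed

text \<open>The total power of the first \<open>k\<close> users that yields the NOMA rates \<open>R\<close> at noise levels \<open>n\<close>.\<close>

fun noma_power :: "(nat \<Rightarrow> real) \<Rightarrow> (nat \<Rightarrow> real) \<Rightarrow> nat \<Rightarrow> real" where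
  "noma_power n R 0 = 0"
| "noma_power n R (Suc k) = exp (R (Suc k)) * noma_power n R k + (exp (R (Suc k)) - 1) * n (Suc k)"

text \<open>The case \<open>i = 1\<close> puts level 0 before the first user in place of the
  arbitrary value \<open>n 0\<close>; hence the steps telescope to \<open>n k\<close>.\<close>

definition noise_step :: "(nat \<Rightarrow> real) \<Rightarrow> nat \<Rightarrow> real" where
  "noise_step n i = n i - (if i = 1 then 0 else n (i - 1))"

lemma sum_noise_step:
  assumes "1 \<le> k"
  shows "(\<Sum>i\<in>{1..k}. noise_step n i) = n k"
  using assms by (induction k rule: dec_induct) (auto simp: noise_step_def)

text \<open>Adding a user with \<open>e = exp (R (Suc k))\<close> turns \<open>exp t - 1\<close>
  into \<open>e * (exp t - 1) + (e - 1)\<close> for each tail sum \<open>t\<close>; the extra terms,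
  weighted by the noise steps, telescope to the new noise level.\<close>

lemma noma_power_eq_abel:
  "noma_power n R k = (\<Sum>i\<in>{1..k}. noise_step n i * (exp (\<Sum>j\<in>{i..k}. R j) - 1))"
proof (induction k)
  case 0
  then show ?case by simp
next
  case (Suc k)
  let ?e = "exp (R (Suc k))"
  have "(\<Sum>i\<in>{1..Suc k}. noise_step n i * (exp (\<Sum>j\<in>{i..Suc k}. R j) - 1))
    = (\<Sum>i\<in>{1..k}. noise_step n i * (exp (\<Sum>j\<in>{i..Suc k}. R j) - 1)) + noise_step n (Suc k) * (?e - 1)"
    by simp
  also have "(\<Sum>i\<in>{1..k}. noise_step n i * (exp (\<Sum>j\<in>{i..Suc k}. R j) - 1))
    = (\<Sum>i\<in>{1..k}. ?e * (noise_step n i * (exp (\<Sum>j\<in>{i..k}. R j) - 1)) + noise_step n i * (?e - 1))"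
    by (intro sum.cong) (auto simp: exp_add algebra_simps)
  also have "\<dots> = ?e * noma_power n R k + (\<Sum>i\<in>{1..k}. noise_step n i) * (?e - 1)"
    unfolding sum.distrib Suc sum_distrib_left[symmetric] sum_distrib_right[symmetric] by simp
  finally have "(\<Sum>i\<in>{1..Suc k}. noise_step n i * (exp (\<Sum>j\<in>{i..Suc k}. R j) - 1))
    = ?e * noma_power n R k + (\<Sum>i\<in>{1..Suc k}. noise_step n i) * (?e - 1)"
    by (simp add: algebra_simps)
  then show ?case using sum_noise_step[of "Suc k" n] by (simp only: noma_power.simps) simp
qed

text \<open>Brings the OMA power into the same form, as a combination of the same noise
  steps.\<close>

lemma sum_eq_abel:
  "(\<Sum>i\<in>{1..k}. n i * c i) = (\<Sum>i\<in>{1..k}. noise_step n i * (\<Sum>j\<in>{i..k}. c j))"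
proof (induction k)
  case 0
  then show ?case by simp
next
  case (Suc k)
  have "(\<Sum>i\<in>{1..Suc k}. noise_step n i * (\<Sum>j\<in>{i..Suc k}. c j))
    = (\<Sum>i\<in>{1..k}. noise_step n i * (\<Sum>j\<in>{i..k}. c j) + noise_step n i * c (Suc k))
      + noise_step n (Suc k) * c (Suc k)"
    by (auto simp: algebra_simps intro!: sum.cong)
  also have "\<dots> = (\<Sum>i\<in>{1..k}. n i * c i) + (\<Sum>i\<in>{1..Suc k}. noise_step n i) * c (Suc k)"
    unfolding sum.distrib Suc[symmetric] sum_distrib_right[symmetric] by (simp add: algebra_simps)
  finally show ?case using sum_noise_step[of "Suc k" n] by simp
qed

text \<open>After both rearrangements, each tail \<open>{i..K}\<close> is one instance of
  \<open>exp_sum_jensen\<close>, weighted by a nonnegative noise step.\<close>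

lemma noma_power_le_oma2_power:
  fixes n R \<alpha> :: "nat \<Rightarrow> real"
  assumes "1 \<le> K" and n1: "0 < n 1"
    and mono: "\<And>i. i \<in> {1..<K} \<Longrightarrow> n i \<le> n (Suc i)"
    and \<alpha>: "resource_fractions K \<alpha>"
    and R: "\<And>i. i \<in> {1..K} \<Longrightarrow> 0 \<le> R i"
  shows "noma_power n R K \<le> (\<Sum>i\<in>{1..K}. n i * (\<alpha> i * (exp (R i / \<alpha> i) - 1)))" (is ?le)
    and "i \<in> {1..<K} \<Longrightarrow> n i < n (Suc i) \<Longrightarrow> k \<in> {1..K} \<Longrightarrow> R k \<noteq> 0 \<Longrightarrow>
      noma_power n R K < (\<Sum>i\<in>{1..K}. n i * (\<alpha> i * (exp (R i / \<alpha> i) - 1)))"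
      (is "_ \<Longrightarrow> _ \<Longrightarrow> _ \<Longrightarrow> _ \<Longrightarrow> ?less")
proof -
  let ?E = "\<lambda>i. exp (\<Sum>j\<in>{i..K}. R j) - 1"
  let ?C = "\<lambda>i. \<Sum>j\<in>{i..K}. \<alpha> j * (exp (R j / \<alpha> j) - 1)"
  have pos: "\<forall>j\<in>{i..K}. 0 < \<alpha> j" if "1 \<le> i" for i
    using \<alpha> that by (auto simp: resource_fractions_def)
  have tail_less: "(\<Sum>j\<in>{i..K}. \<alpha> j) < 1" if "1 < i" for i
  proof -
    have "0 < \<alpha> 1" "\<And>j. j \<in> {1..K} \<Longrightarrow> 0 < \<alpha> j"
      using \<alpha> \<open>1 \<le> K\<close> by (auto simp: resource_fractions_def)
    then have "(\<Sum>j\<in>{i..K}. \<alpha> j) < (\<Sum>j\<in>{1..K}. \<alpha> j)"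
      using that \<open>1 \<le> K\<close> by (intro sum_strict_mono2[of _ _ 1]) (auto simp: less_imp_le)
    then show ?thesis using \<alpha> by (simp add: resource_fractions_def)
  qed
  have tail: "(\<Sum>j\<in>{i..K}. \<alpha> j) \<le> 1" if "1 \<le> i" for i
    using tail_less[of i] that \<alpha> by (cases "i = 1") (auto simp: resource_fractions_def)
  have step: "0 \<le> noise_step n i" if "i \<in> {1..K}" for i
  proof (cases "i = 1")
    case True
    then show ?thesis using n1 by (simp add: noise_step_def)
  next
    case False
    then have "n (i - 1) \<le> n (Suc (i - 1))" using that by (intro mono) auto
    then show ?thesis using False that by (simp add: noise_step_def)
  qed
  have EC: "noise_step n i * ?E i \<le> noise_step n i * ?C i" if "i \<in> {1..K}" for i
    using that step pos tail by (intro mult_left_mono exp_sum_jensen(1)) auto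
  show ?le
    unfolding noma_power_eq_abel sum_eq_abel[where c = "\<lambda>i. \<alpha> i * (exp (R i / \<alpha> i) - 1)"]
    by (intro sum_mono EC)
  assume i: "i \<in> {1..<K}" "n i < n (Suc i)" and k: "k \<in> {1..K}" "R k \<noteq> 0"
  have strict: ?less if l: "l \<in> {1..K}" "0 < noise_step n l" "(\<Sum>j\<in>{l..K}. R j) \<noteq> 0"
    "(\<Sum>j\<in>{l..K}. \<alpha> j) < 1 \<or> (\<exists>j\<in>{l..K}. R j = 0)" for l
  proof -
    have "noise_step n l * ?E l < noise_step n l * ?C l"
      using l pos tail by (intro mult_strict_left_mono exp_sum_jensen(2)) auto
    then show ?thesis
      unfolding noma_power_eq_abel sum_eq_abel[where c = "\<lambda>i. \<alpha> i * (exp (R i / \<alpha> i) - 1)"]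
      using l(1) EC by (intro sum_strict_mono_ex1) auto
  qed
  show ?less
  \<comment> \<open>Selects the strict term. If \<open>R K = 0\<close>, the full tail
    \<open>{1..K}\<close> works: its step is \<open>n 1 > 0\<close>, its rate sum is positive, and
    user \<open>K\<close> has rate 0. Otherwise the tail from \<open>Suc i\<close> works: it has a
    positive rate sum and lacks the weight \<open>\<alpha> 1\<close>.\<close>
  proof (cases "R K = 0")
    case True
    have "0 < (\<Sum>j\<in>{1..K}. R j)"
      using k R by (intro sum_pos2[of _ k]) (auto simp: less_le)
    then show ?thesis
      using True \<open>1 \<le> K\<close> n1 by (intro strict[of 1]) (auto simp: noise_step_def)
  next
    case False
    then have "0 < (\<Sum>j\<in>{Suc i..K}. R j)"
      using i R[of K] R by (intro sum_pos2[of _ K]) (auto simp: less_le)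
    then show ?thesis
      using i tail_less[of "Suc i"] by (intro strict[of "Suc i"]) (auto simp: noise_step_def)
  qed
qed

section \<open>Realising the rates by NOMA\<close>

text \<open>The rate of user \<open>i\<close> involves only the powers up to \<open>i\<close>, so
  the rate equations can be solved one after another; the partial sums of the solution obey the
  recursion of \<open>noma_power\<close>.\<close>

lemma noma_point_of_rates:
  fixes N0 :: real and R :: "nat \<Rightarrow> real"
  assumes "1 \<le> K" "0 < N0" and h: "\<forall>i\<in>{1..K}. h i \<noteq> 0"
    and R: "\<And>i. i \<in> {1..K} \<Longrightarrow> 0 \<le> R i"
  obtains p where "\<And>i. i \<in> {1..K} \<Longrightarrow> 0 \<le> p i"
    and "(\<Sum>i\<in>{1..K}. p i) = noma_power (\<lambda>i. N0 / (cmod (h i))\<^sup>2) R K"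
    and "\<And>i. i \<in> {1..K} \<Longrightarrow> noma_rate h N0 p i = R i"
proof
  define S where "S = noma_power (\<lambda>i. N0 / (cmod (h i))\<^sup>2) R"
  define p where "p = (\<lambda>i. S i - S (i - 1))"
  have sum_p: "(\<Sum>j\<in>{1..k}. p j) = S k" for k
    by (induction k) (auto simp: p_def S_def)
  show "(\<Sum>i\<in>{1..K}. p i) = noma_power (\<lambda>i. N0 / (cmod (h i))\<^sup>2) R K"
    using sum_p[of K] by (simp add: S_def)
  have S_nonneg: "k \<le> K \<Longrightarrow> 0 \<le> S k" for k
  proof (induction k)
    case (Suc k)
    then show ?case using R[of "Suc k"] assms(2)
      by (auto simp: S_def intro!: add_nonneg_nonneg divide_nonneg_nonneg mult_nonneg_nonneg)
  qed (simp add: S_def)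
  show "0 \<le> p i" "noma_rate h N0 p i = R i" if "i \<in> {1..K}" for i
  proof -
    define k where "k = i - 1"
    then have k: "i = Suc k" "k < K" using that by auto
    have g: "0 < (cmod (h i))\<^sup>2" using h that by auto
    have S: "0 \<le> S k" using S_nonneg k by simp
    have p: "p i = (exp (R i) - 1) * (S k + N0 / (cmod (h i))\<^sup>2)"
      by (simp add: p_def S_def k algebra_simps)
    show "0 \<le> p i"
      unfolding p using R[OF that] S assms(2) by (intro mult_nonneg_nonneg) auto
    have "{1..<i} = {1..k}" using k by auto
    then have I: "(\<Sum>j\<in>{1..<i}. p j) = S k" using sum_p by simp
    have D: "0 < N0 + (cmod (h i))\<^sup>2 * S k"
      using S assms(2) by (simp add: add_pos_nonneg)
    have "p i * (cmod (h i))\<^sup>2 = (exp (R i) - 1) * (N0 + (cmod (h i))\<^sup>2 * S k)"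
      unfolding p using g by (simp add: field_simps)
    then show "noma_rate h N0 p i = R i"
      unfolding noma_rate_def I using D by simp
  qed
qed

lemma noma_opt_value_strict:
  fixes N0 P r :: real
  assumes "1 \<le> K" "0 < N0" and h: "\<forall>i\<in>{1..K}. h i \<noteq> 0"
    and f: "noma_feasible K h N0 P r p" and less: "(\<Sum>i\<in>{1..K}. p i) < P"
  shows "noma_sum_rate K h N0 p < noma_opt_value K h N0 P r"
proof -
  define q where "q = p(K := p K + (P - (\<Sum>i\<in>{1..K}. p i)))"
  have p: "\<And>i. i \<in> {1..K} \<Longrightarrow> 0 \<le> p i" "\<And>i. i \<in> {1..K} \<Longrightarrow> r \<le> noma_rate h N0 p i"
    using f noma_feasible_iff[OF assms(1)] by blast+
  have rate: "noma_rate h N0 q i = noma_rate h N0 p i" if "i \<in> {1..K}" "i \<noteq> K" for i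
    using that by (intro noma_rate_cong) (auto simp: q_def)
  have rateK: "noma_rate h N0 p K < noma_rate h N0 q K"
  proof -
    have g: "0 < (cmod (h K))\<^sup>2" using h assms(1) by auto
    define D where "D = N0 + (cmod (h K))\<^sup>2 * (\<Sum>j\<in>{1..<K}. p j)"
    have D: "0 < D"
      unfolding D_def using p(1) assms(2) by (intro add_pos_nonneg mult_nonneg_nonneg sum_nonneg) auto
    have "(\<Sum>j\<in>{1..<K}. q j) = (\<Sum>j\<in>{1..<K}. p j)"
      by (intro sum.cong) (auto simp: q_def)
    then have "noma_rate h N0 q K = ln (1 + q K * (cmod (h K))\<^sup>2 / D)"
      "noma_rate h N0 p K = ln (1 + p K * (cmod (h K))\<^sup>2 / D)"
      by (simp_all add: noma_rate_def D_def)
    moreover have "p K * (cmod (h K))\<^sup>2 / D < q K * (cmod (h K))\<^sup>2 / D"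
      using D g less by (intro divide_strict_right_mono mult_strict_right_mono) (auto simp: q_def)
    moreover have "0 \<le> p K * (cmod (h K))\<^sup>2 / D"
      using D p(1)[of K] assms(1) by simp
    ultimately show ?thesis by simp
  qed
  have "(\<Sum>i\<in>{1..K}. q i) = q K + (\<Sum>i\<in>{1..K}-{K}. q i)"
    using assms(1) by (intro sum.remove) auto
  also have "(\<Sum>i\<in>{1..K}-{K}. q i) = (\<Sum>i\<in>{1..K}-{K}. p i)"
    by (intro sum.cong) (auto simp: q_def)
  also have "q K + \<dots> = P"
    using sum.remove[of "{1..K}" K p] assms(1) by (simp add: q_def)
  finally have sum_q: "(\<Sum>i\<in>{1..K}. q i) = P" .
  have q_ge: "noma_rate h N0 p i \<le> noma_rate h N0 q i" if "i \<in> {1..K}" for i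
    using rate[OF that] rateK by (cases "i = K") auto
  have "\<forall>i\<in>{1..K}. 0 \<le> q i" using p(1) less by (auto simp: q_def)
  then have "noma_feasible K h N0 P r q"
    unfolding noma_feasible_iff[OF assms(1)] using sum_q order_trans[OF p(2) q_ge] by auto
  moreover have "noma_sum_rate K h N0 p < noma_sum_rate K h N0 q"
    unfolding noma_sum_rate_def using q_ge rateK assms(1) by (intro sum_strict_mono_ex1) auto
  ultimately show ?thesis
    using noma_opt_value_attained[OF assms(1,2) f] by fastforce
qed

section \<open>Feasibility of OMA-TYPE-II and comparison with NOMA\<close>

lemma oma2_feasible_iff:
  assumes "1 \<le> K"
  shows "oma2_feasible K h N0 P r p \<alpha> \<longleftrightarrow>
    (\<forall>i\<in>{1..K}. 0 \<le> p i) \<and> resource_fractions K \<alpha> \<and> (\<Sum>i\<in>{1..K}. p i) \<le> P \<and>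
    (\<forall>i\<in>{1..K}. r \<le> oma2_rate h N0 p \<alpha> i)"
  using assms by (simp add: oma2_feasible_def)

text \<open>At minimising fractions, inverting the rate formula at \<open>r\<close> gives powers for
  which every user has rate exactly \<open>r\<close>, and their total is the minimal power.\<close>

lemma oma2_feasible_of_min_power:
  fixes N0 P r :: real
  assumes "1 \<le> K" "0 < N0" "0 \<le> r" and h: "\<forall>i\<in>{1..K}. h i \<noteq> 0"
    and "oma2_min_power K h N0 r \<le> P"
  shows "\<exists>p \<alpha>. oma2_feasible K h N0 P r p \<alpha>"
proof -
  obtain \<alpha> where \<alpha>: "resource_fractions K \<alpha>" "oma2_min_power K h N0 r = oma2_power K h N0 r \<alpha>"
    using oma2_min_power_attained[OF assms(1-4)] by blast
  define p where "p = (\<lambda>i. N0 * ((exp (r / \<alpha> i) - 1) * \<alpha> i / (cmod (h i))\<^sup>2))"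
  have pos: "0 < \<alpha> i" if "i \<in> {1..K}" for i
    using \<alpha> that by (auto simp: resource_fractions_def)
  have "0 \<le> p i" if "i \<in> {1..K}" for i
    unfolding p_def using pos[OF that] assms(2,3)
    by (intro mult_nonneg_nonneg divide_nonneg_nonneg) auto
  moreover have "(\<Sum>i\<in>{1..K}. p i) \<le> P"
    using assms(5) \<alpha>(2) by (simp add: p_def oma2_power_def sum_distrib_left)
  moreover have "oma2_rate h N0 p \<alpha> i = r" if "i \<in> {1..K}" for i
  proof -
    have "p i * (cmod (h i))\<^sup>2 / (\<alpha> i * N0) = exp (r / \<alpha> i) - 1"
      using pos[OF that] assms(2) h that by (simp add: p_def field_simps)
    then show ?thesis using pos[OF that] by (simp add: oma2_rate_def)
  qed
  ultimately have "oma2_feasible K h N0 P r p \<alpha>"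
    unfolding oma2_feasible_iff[OF assms(1)] using \<alpha>(1) by auto
  then show ?thesis by blast
qed

text \<open>The NOMA point with the same rates fits into the power budget. The equality case appears
  as its contrapositive: unequal gains leave slack, which \<open>noma_opt_value_strict\<close>
  exploits.\<close>

lemma oma2_sum_rate_le_noma_opt_value:
  fixes N0 P r :: real
  assumes "1 \<le> K" "0 < N0" "0 < P" "0 \<le> r" and h: "\<forall>i\<in>{1..K}. h i \<noteq> 0"
    and mono: "\<forall>i\<in>{1..K}. \<forall>j\<in>{1..K}. i \<le> j \<longrightarrow> cmod (h j) \<le> cmod (h i)"
    and f: "oma2_feasible K h N0 P r p \<alpha>"
  shows "oma2_sum_rate K h N0 p \<alpha> \<le> noma_opt_value K h N0 P r"
    and "\<not> (\<forall>i\<in>{1..K}. \<forall>j\<in>{1..K}. cmod (h i) = cmod (h j)) \<Longrightarrow>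
      oma2_sum_rate K h N0 p \<alpha> < noma_opt_value K h N0 P r"
proof -
  define R where "R = oma2_rate h N0 p \<alpha>"
  define n where "n = (\<lambda>i. N0 / (cmod (h i))\<^sup>2)"
  have fs: "\<And>i. i \<in> {1..K} \<Longrightarrow> 0 \<le> p i" "resource_fractions K \<alpha>" "(\<Sum>i\<in>{1..K}. p i) \<le> P"
    "\<And>i. i \<in> {1..K} \<Longrightarrow> r \<le> R i"
    using f unfolding oma2_feasible_iff[OF assms(1)] R_def by blast+
  have R: "0 \<le> R i" if "i \<in> {1..K}" for i using fs(4)[OF that] assms(4) by simp
  \<comment> \<open>Inverting the rate formula identifies the right-hand side of the power
    comparison with the power that OMA actually uses.\<close>
  have power: "n i * (\<alpha> i * (exp (R i / \<alpha> i) - 1)) = p i" if "i \<in> {1..K}" for i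
  proof -
    have a: "0 < \<alpha> i" using fs(2) that by (auto simp: resource_fractions_def)
    have g: "0 < (cmod (h i))\<^sup>2" using h that by auto
    have "0 \<le> p i * (cmod (h i))\<^sup>2 / (\<alpha> i * N0)" using a assms(2) fs(1)[OF that] by simp
    then have "exp (R i / \<alpha> i) = 1 + p i * (cmod (h i))\<^sup>2 / (\<alpha> i * N0)"
      using a by (simp add: R_def oma2_rate_def)
    then show ?thesis using a g assms(2) by (simp add: n_def)
  qed
  have sum_power: "(\<Sum>i\<in>{1..K}. n i * (\<alpha> i * (exp (R i / \<alpha> i) - 1))) = (\<Sum>i\<in>{1..K}. p i)"
    by (intro sum.cong power) auto
  have n1: "0 < n 1" using assms h by (simp add: n_def)
  have less_iff: "n i \<le> n (Suc i)" "cmod (h i) \<noteq> cmod (h (Suc i)) \<Longrightarrow> n i < n (Suc i)"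
    if "i \<in> {1..<K}" for i
  proof -
    have le: "cmod (h (Suc i)) \<le> cmod (h i)" using mono that by simp
    have nz: "h i \<noteq> 0" "h (Suc i) \<noteq> 0" using h that by auto
    show "n i \<le> n (Suc i)"
      unfolding n_def using le assms(2) nz by (intro divide_left_mono power_mono) auto
    assume "cmod (h i) \<noteq> cmod (h (Suc i))"
    then have "(cmod (h (Suc i)))\<^sup>2 < (cmod (h i))\<^sup>2"
      using le by (intro power_strict_mono) auto
    then show "n i < n (Suc i)"
      unfolding n_def using assms(2) nz by (intro divide_strict_left_mono) auto
  qed
  obtain q where q: "\<And>i. i \<in> {1..K} \<Longrightarrow> 0 \<le> q i" "(\<Sum>i\<in>{1..K}. q i) = noma_power n R K"
    "\<And>i. i \<in> {1..K} \<Longrightarrow> noma_rate h N0 q i = R i"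
  proof (rule noma_point_of_rates[where R = R, OF assms(1,2) h R, folded n_def])
  qed blast+
  have le: "(\<Sum>i\<in>{1..K}. q i) \<le> (\<Sum>i\<in>{1..K}. p i)"
    using noma_power_le_oma2_power(1)[where R = R, OF assms(1) n1 less_iff(1) fs(2) R] sum_power q(2) by simp
  have fq: "noma_feasible K h N0 P r q"
    unfolding noma_feasible_iff[OF assms(1)] using q fs le by auto
  have same: "noma_sum_rate K h N0 q = oma2_sum_rate K h N0 p \<alpha>"
    unfolding noma_sum_rate_def oma2_sum_rate_def using q(3) by (simp add: R_def)
  show "oma2_sum_rate K h N0 p \<alpha> \<le> noma_opt_value K h N0 P r"
    using noma_opt_value_attained[OF assms(1,2) fq] fq same by auto
  assume unequal: "\<not> (\<forall>i\<in>{1..K}. \<forall>j\<in>{1..K}. cmod (h i) = cmod (h j))"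
  \<comment> \<open>The strict comparison needs a jump between neighbouring users.\<close>
  have "\<exists>i\<in>{1..<K}. cmod (h i) \<noteq> cmod (h (Suc i))"
  proof (rule ccontr)
    assume "\<not> ?thesis"
    then have step: "\<And>i. i \<in> {1..<K} \<Longrightarrow> cmod (h (Suc i)) = cmod (h i)" by metis
    have "cmod (h i) = cmod (h 1)" if "1 \<le> i" "i \<le> K" for i
      using that by (induction i rule: dec_induct) (auto simp: step)
    then have "cmod (h i) = cmod (h j)" if "i \<in> {1..K}" "j \<in> {1..K}" for i j
      using that by (metis atLeastAtMost_iff)
    then show False using unequal by blast
  qed
  then obtain i where i: "i \<in> {1..<K}" "cmod (h i) \<noteq> cmod (h (Suc i))" by blast
  have "(\<Sum>i\<in>{1..K}. q i) < P"
  proof (cases "\<exists>k\<in>{1..K}. R k \<noteq> 0")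
    case True
    then obtain k where "k \<in> {1..K}" "R k \<noteq> 0" by blast
    then have "noma_power n R K < (\<Sum>i\<in>{1..K}. n i * (\<alpha> i * (exp (R i / \<alpha> i) - 1)))"
      using noma_power_le_oma2_power(2)[where R = R, OF assms(1) n1 less_iff(1) fs(2) R i(1) less_iff(2)[OF i]] by blast
    then show ?thesis using sum_power q(2) fs(3) by simp
  next
    \<comment> \<open>With all rates zero the power comparison need not be strict; the slack then
      comes from \<open>0 < P\<close>.\<close>
    case False
    then have "(\<Sum>i\<in>{1..K}. p i) = 0" using power by (intro sum.neutral) force
    then show ?thesis using le assms(3) by simp
  qed
  then show "oma2_sum_rate K h N0 p \<alpha> < noma_opt_value K h N0 P r"
    using noma_opt_value_strict[OF assms(1,2) h fq] same by simp
qed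

theorem theorem3:
  fixes K :: nat and h :: "nat \<Rightarrow> complex" and N0 P rmin :: real
  assumes "1 \<le> K" and "0 < N0" and "0 < P" and "0 \<le> rmin"
    and "\<forall>i\<in>{1..K}. h i \<noteq> 0"
    and "\<forall>i\<in>{1..K}. \<forall>j\<in>{1..K}. i \<le> j \<longrightarrow> cmod (h j) \<le> cmod (h i)"
    and "oma2_min_power K h N0 rmin \<le> P"
  shows "(\<exists>p \<alpha>. oma2_feasible K h N0 P rmin p \<alpha>) \<and>
    (\<forall>p \<alpha>. oma2_optimal K h N0 P rmin p \<alpha> \<longrightarrow>
       oma2_sum_rate K h N0 p \<alpha> \<le> noma_opt_value K h N0 P rmin \<and>
       (oma2_sum_rate K h N0 p \<alpha> = noma_opt_value K h N0 P rmin \<longrightarrow>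
          (\<forall>i\<in>{1..K}. \<forall>j\<in>{1..K}. cmod (h i) = cmod (h j))))"
proof (intro conjI allI impI)
  show "\<exists>p \<alpha>. oma2_feasible K h N0 P rmin p \<alpha>"
    using oma2_feasible_of_min_power assms by blast
next
  fix p \<alpha> assume "oma2_optimal K h N0 P rmin p \<alpha>"
  then have f: "oma2_feasible K h N0 P rmin p \<alpha>" by (simp add: oma2_optimal_def)
  note bounds = oma2_sum_rate_le_noma_opt_value[OF assms(1-6) f]
  show "oma2_sum_rate K h N0 p \<alpha> \<le> noma_opt_value K h N0 P rmin" by (rule bounds(1))
  assume "oma2_sum_rate K h N0 p \<alpha> = noma_opt_value K h N0 P rmin"
  then show "\<forall>i\<in>{1..K}. \<forall>j\<in>{1..K}. cmod (h i) = cmod (h j)"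
    using bounds(2) by auto
qed

end
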